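(* In the setting of the context, the following hold. (i) For all $s$, $i$ and all $\boldsymbol\theta_s=(\boldsymbol\beta,\mathbf A,\mathbf B_s,\lambda_s)$, the map $\boldsymbol\xi_{si}\mapsto\tilde l_{si}(\boldsymbol\theta_s,\boldsymbol\xi_{si})$ possesses a unique maximizer $\boldsymbol\xi_{si}(\boldsymbol\theta_s)=\arg\max_{\boldsymbol\xi_{si}}\tilde l_{si}(\boldsymbol\theta_s,\boldsymbol\xi_{si})$. (ii) Put $\rho_p(\boldsymbol\theta_s;\mathbf x_{si},\mathbf z_{si})=\tilde l_{si}(\boldsymbol\theta_s,\boldsymbol\xi_{si}(\boldsymbol\theta_s))$. The maximum variational likelihood estimator $\widehat{\boldsymbol\theta}$ is equal to the maximizer of the profiled variational log-likelihood $$\boldsymbol\theta\mapsto\sum_{s=1}^S\sum_{i=1}^{n_s}\rho_p(\boldsymbol\theta_s;\mathbf x_{si},\mathbf z_{si}).$$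
   Context: Data: for $s=1,\dots,S$ and $i=1,\dots,n_s$, a vector of nonnegative integer counts $\mathbf x_{si}=(x_{si1},\dots,x_{sip})^{\mathrm T}$, a covariate vector $\mathbf z_{si}\in\mathbb R^d$, and a known constant $a_{si}>0$. Model parameters: $\boldsymbol\theta=(\boldsymbol\theta_s,\,s\le S)$ with $\boldsymbol\theta_s=(\boldsymbol\beta,\mathbf A,\mathbf B_s,\lambda_s)$, where $\boldsymbol\beta=(\boldsymbol\beta_1,\dots,\boldsymbol\beta_p)^{\mathrm T}\in\mathbb R^{p\times d}$ and $\mathbf A=(\boldsymbol\alpha_1,\dots,\boldsymbol\alpha_p)^{\mathrm T}\in\mathbb R^{p\times q}$ are shared across studies, $\mathbf B_s=(\boldsymbol\gamma_{s1},\dots,\boldsymbol\gamma_{sp})^{\mathrm T}\in\mathbb R^{p\times q_s}$, and $\lambda_s>0$. Variational parameters: $\boldsymbol\xi_{si}=\{\mu_{sij},\sigma^2_{sij},\mathbf m_{f,si},\mathbf S_{f,si},\mathbf m_{h,si},\mathbf S_{h,si},\,j\le p\}$ with $\mu_{sij}\in\mathbb R$, $\sigma_{sij}^2>0$, $\mathbf m_{f,si}\in\mathbb R^q$, $\mathbf m_{h,si}\in\mathbb R^{q_s}$, and $\mathbf S_{f,si}\in\mathbb R^{q\times q}$, $\mathbf S_{h,si}\in\mathbb R^{q_s\times q_s}$ symmetric positive definite. $\boldsymbol\xi=\{\boldsymbol\xi_{si}\}_{s,i}$. Variational lower bound (the evidence lower bound for one observation under the mean-field Gaussian family $\prod_jN(y_{sij};\mu_{sij},\sigma_{sij}^2)\,N(\mathbf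 f_{si};\mathbf m_{f,si},\mathbf S_{f,si})\,N(\mathbf h_{si};\mathbf m_{h,si},\mathbf S_{h,si})$): $$\begin{aligned}\tilde l_{si}(\boldsymbol\theta_s,\boldsymbol\xi_{si})=&\sum_{j=1}^p\Big\{x_{sij}\mu_{sij}-a_{si}\exp(\mu_{sij}+\sigma_{sij}^2/2)-\tfrac12\big\{(\mu_{sij}-\mathbf z_{si}^{\mathrm T}\boldsymbol\beta_j-\boldsymbol\alpha_j^{\mathrm T}\mathbf m_{f,si}-\boldsymbol\gamma_{sj}^{\mathrm T}\mathbf m_{h,si})^2/\lambda_s\\&+\lambda_s^{-1}(\sigma_{sij}^2+\boldsymbol\alpha_j^{\mathrm T}\mathbf S_{f,si}\boldsymbol\alpha_j+\boldsymbol\gamma_{sj}^{\mathrm T}\mathbf S_{h,si}\boldsymbol\gamma_{sj})+\ln\lambda_s\big\}\Big\}\\&-\tfrac12\big\{\mathbf m_{f,si}^{\mathrm T}\mathbf m_{f,si}+\mathrm{Tr}(\mathbf S_{f,si})+\mathbf m_{h,si}^{\mathrm T}\mathbf m_{h,si}+\mathrm{Tr}(\mathbf S_{h,si})\big\}\\&+\tfrac12\Big(\sum_{j=1}^p\ln\sigma_{sij}^2+\ln|\mathbf S_{f,si}|+\ln|\mathbf S_{h,si}|\Big)+c,\end{aligned}$$ with $c$ a constant not depending on $(\boldsymbol\theta_s,\boldsymbol\xi_{si})$ and $|\cdot|$ the determinant. The maximum variational likelihood estimator $\widehat{\boldsymbol\theta}$ is the $\boldsymbol\theta$-component of the maximizer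 $(\widehat{\boldsymbol\theta},\widehat{\boldsymbol\xi})$ of $\tilde l(\boldsymbol\theta,\boldsymbol\xi)=\sum_{s,i}\tilde l_{si}(\boldsymbol\theta_s,\boldsymbol\xi_{si})$ jointly over $(\boldsymbol\theta,\boldsymbol\xi)$, with $\boldsymbol\theta$ ranging over the parameter space. (If maximizers are not unique, both are understood as sets of maximizers.) *)

theory Defs
  imports Complex_Main "HOL-Library.FuncSet" "Jordan_Normal_Form.Determinant"
begin

text \<open>
  The factor dimension \<open>qs s\<close> varies with the study \<open>s\<close>, so vectors and matrices are
  those of \<open>Jordan_Normal_Form\<close>, whose dimensions are values constrained by
  \<^const>\<open>carrier_vec\<close> and \<^const>\<open>carrier_mat\<close>. Studies and observations are indexed from
  \<open>1\<close>; vector components and matrix rows, and hence the variables \<open>j\<close>, are indexed from \<open>0\<close>.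
\<close>

definition mat_trace :: "real mat \<Rightarrow> real" where
  "mat_trace M = (\<Sum>k<dim_row M. M $$ (k, k))"

definition pos_def_mats :: "nat \<Rightarrow> real mat set" where
  "pos_def_mats k = {M \<in> carrier_mat k k.
     transpose_mat M = M \<and> (\<forall>v\<in>carrier_vec k. v \<noteq> 0\<^sub>v k \<longrightarrow> v \<bullet> (M *\<^sub>v v) > 0)}"

text \<open>
  \<open>study_param\<close> is the parameter of one study, \<open>(\<beta>, A, B\<^sub>s, \<lambda>\<^sub>s)\<close>; the \<open>j\<close>-th rows of its
  matrices are \<open>\<beta>\<^sub>j\<close>, \<open>\<alpha>\<^sub>j\<close> and \<open>\<gamma>\<^sub>s\<^sub>j\<close>. In \<open>model_param\<close> the first two components are
  shared by all studies and the last two are families over the studies.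
\<close>

record study_param =
  sp_beta :: "real mat"
  sp_A :: "real mat"
  sp_B :: "real mat"
  sp_lambda :: real

record model_param =
  mp_beta :: "real mat"
  mp_A :: "real mat"
  mp_B :: "nat \<Rightarrow> real mat"
  mp_lambda :: "nat \<Rightarrow> real"

definition at_study :: "model_param \<Rightarrow> nat \<Rightarrow> study_param" where
  "at_study \<theta> s = \<lparr>sp_beta = mp_beta \<theta>, sp_A = mp_A \<theta>,
     sp_B = mp_B \<theta> s, sp_lambda = mp_lambda \<theta> s\<rparr>"

definition study_params :: "nat \<Rightarrow> nat \<Rightarrow> nat \<Rightarrow> nat \<Rightarrow> study_param set" where
  "study_params p d q r = {\<theta>. sp_beta \<theta> \<in> carrier_mat p d \<and> sp_A \<theta> \<in> carrier_mat p q \<and>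
     sp_B \<theta> \<in> carrier_mat p r \<and> sp_lambda \<theta> > 0}"

text \<open>
  The families over the studies are extensional, so that every model parameter has exactly
  one representative.
\<close>

definition model_params ::
    "nat \<Rightarrow> nat \<Rightarrow> nat \<Rightarrow> (nat \<Rightarrow> nat) \<Rightarrow> nat \<Rightarrow> model_param set" where
  "model_params p d q qs S = {\<theta>. mp_beta \<theta> \<in> carrier_mat p d \<and> mp_A \<theta> \<in> carrier_mat p q \<and>
     mp_B \<theta> \<in> (\<Pi>\<^sub>E s\<in>{1..S}. carrier_mat p (qs s)) \<and>
     mp_lambda \<theta> \<in> {1..S} \<rightarrow>\<^sub>E {0<..}}"

text \<open>The field \<open>vp_sigma2\<close> holds the variances \<open>\<sigma>\<^sup>2\<close>, not the standard deviations.\<close>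

record var_param =
  vp_mu :: "real vec"
  vp_sigma2 :: "real vec"
  vp_mf :: "real vec"
  vp_Sf :: "real mat"
  vp_mh :: "real vec"
  vp_Sh :: "real mat"

definition var_params :: "nat \<Rightarrow> nat \<Rightarrow> nat \<Rightarrow> var_param set" where
  "var_params p q r = {\<xi>. vp_mu \<xi> \<in> carrier_vec p \<and>
     vp_sigma2 \<xi> \<in> carrier_vec p \<and> (\<forall>j<p. vp_sigma2 \<xi> $ j > 0) \<and>
     vp_mf \<xi> \<in> carrier_vec q \<and> vp_Sf \<xi> \<in> pos_def_mats q \<and>
     vp_mh \<xi> \<in> carrier_vec r \<and> vp_Sh \<xi> \<in> pos_def_mats r}"

definition var_families ::
    "nat \<Rightarrow> nat \<Rightarrow> (nat \<Rightarrow> nat) \<Rightarrow> nat \<Rightarrow> (nat \<Rightarrow> nat) \<Rightarrow> (nat \<Rightarrow> nat \<Rightarrow> var_param) set" where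
  "var_families p q qs S n = (\<Pi>\<^sub>E s\<in>{1..S}. \<Pi>\<^sub>E i\<in>{1..n s}. var_params p q (qs s))"

text \<open>
  The lower bound for one observation with counts \<open>x\<close>, covariates \<open>z\<close> and known constant
  \<open>a\<close>; \<open>c\<close> is the additive constant, which may depend on the observation but not on
  \<open>\<theta>\<close> and \<open>\<xi>\<close>.
\<close>

definition elbo ::
    "nat \<Rightarrow> nat vec \<Rightarrow> real vec \<Rightarrow> real \<Rightarrow> real \<Rightarrow> study_param \<Rightarrow> var_param \<Rightarrow> real" where
  "elbo p x z a c \<theta> \<xi> =
     (\<Sum>j<p.
        real (x $ j) * vp_mu \<xi> $ j - a * exp (vp_mu \<xi> $ j + vp_sigma2 \<xi> $ j / 2)
        - 1/2 * ((vp_mu \<xi> $ j - z \<bullet> row (sp_beta \<theta>) j - row (sp_A \<theta>) j \<bullet> vp_mf \<xi>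
                    - row (sp_B \<theta>) j \<bullet> vp_mh \<xi>)\<^sup>2 / sp_lambda \<theta>
                 + 1 / sp_lambda \<theta> *
                   (vp_sigma2 \<xi> $ j + row (sp_A \<theta>) j \<bullet> (vp_Sf \<xi> *\<^sub>v row (sp_A \<theta>) j)
                      + row (sp_B \<theta>) j \<bullet> (vp_Sh \<xi> *\<^sub>v row (sp_B \<theta>) j))
                 + ln (sp_lambda \<theta>)))
     - 1/2 * (vp_mf \<xi> \<bullet> vp_mf \<xi> + mat_trace (vp_Sf \<xi>) + vp_mh \<xi> \<bullet> vp_mh \<xi> + mat_trace (vp_Sh \<xi>))
     + 1/2 * ((\<Sum>j<p. ln (vp_sigma2 \<xi> $ j)) + ln (det (vp_Sf \<xi>)) + ln (det (vp_Sh \<xi>)))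
     + c"

definition total_elbo ::
    "nat \<Rightarrow> nat \<Rightarrow> (nat \<Rightarrow> nat) \<Rightarrow> (nat \<Rightarrow> nat \<Rightarrow> nat vec) \<Rightarrow> (nat \<Rightarrow> nat \<Rightarrow> real vec) \<Rightarrow>
     (nat \<Rightarrow> nat \<Rightarrow> real) \<Rightarrow> (nat \<Rightarrow> nat \<Rightarrow> real) \<Rightarrow>
     model_param \<Rightarrow> (nat \<Rightarrow> nat \<Rightarrow> var_param) \<Rightarrow> real" where
  "total_elbo p S n x z a c \<theta> \<xi> =
     (\<Sum>s=1..S. \<Sum>i=1..n s. elbo p (x s i) (z s i) (a s i) (c s i) (at_study \<theta> s) (\<xi> s i))"

text \<open>
  The maximum variational likelihood estimator over the parameter space \<open>\<Theta>\<close>, as the set of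
  \<open>\<theta>\<close>-components of the joint maximizers.
\<close>

definition mvle ::
    "nat \<Rightarrow> nat \<Rightarrow> (nat \<Rightarrow> nat) \<Rightarrow> nat \<Rightarrow> (nat \<Rightarrow> nat) \<Rightarrow> (nat \<Rightarrow> nat \<Rightarrow> nat vec) \<Rightarrow>
     (nat \<Rightarrow> nat \<Rightarrow> real vec) \<Rightarrow> (nat \<Rightarrow> nat \<Rightarrow> real) \<Rightarrow> (nat \<Rightarrow> nat \<Rightarrow> real) \<Rightarrow>
     model_param set \<Rightarrow> model_param set" where
  "mvle p q qs S n x z a c \<Theta> =
     fst ` {(\<theta>, \<xi>). is_arg_max (\<lambda>(\<theta>, \<xi>). total_elbo p S n x z a c \<theta> \<xi>)
                         (\<lambda>(\<theta>, \<xi>). \<theta> \<in> \<Theta> \<and> \<xi> \<in> var_families p q qs S n) (\<theta>, \<xi>)}"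

text \<open>
  Here \<open>r\<close> is the dimension of the study-specific factors. \<^const>\<open>arg_max\<close> picks an
  arbitrary maximizer, which is the maximizer when it is unique.
\<close>

definition rho ::
    "nat \<Rightarrow> nat \<Rightarrow> nat \<Rightarrow> nat vec \<Rightarrow> real vec \<Rightarrow> real \<Rightarrow> real \<Rightarrow> study_param \<Rightarrow> real" where
  "rho p q r x z a c \<theta> =
     elbo p x z a c \<theta> (arg_max (elbo p x z a c \<theta>) (\<lambda>\<xi>. \<xi> \<in> var_params p q r))"

definition profile_loglik ::
    "nat \<Rightarrow> nat \<Rightarrow> (nat \<Rightarrow> nat) \<Rightarrow> nat \<Rightarrow> (nat \<Rightarrow> nat) \<Rightarrow> (nat \<Rightarrow> nat \<Rightarrow> nat vec) \<Rightarrow>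
     (nat \<Rightarrow> nat \<Rightarrow> real vec) \<Rightarrow> (nat \<Rightarrow> nat \<Rightarrow> real) \<Rightarrow> (nat \<Rightarrow> nat \<Rightarrow> real) \<Rightarrow>
     model_param \<Rightarrow> real" where
  "profile_loglik p q qs S n x z a c \<theta> =
     (\<Sum>s=1..S. \<Sum>i=1..n s. rho p q (qs s) (x s i) (z s i) (a s i) (c s i) (at_study \<theta> s))"

end

theory Submission
  imports "HOL-Analysis.Function_Topology" Defs
begin

text \<open>
  The bound splits into three independent parts. As a function of a factor covariance \<open>T\<close> it is
  \<open>(ln |T| - Tr (T N)) / 2\<close> with \<open>N = I + A\<^sup>T A / \<lambda>\<close>; a Cholesky factor \<open>N = L L\<^sup>T\<close> reduces this to
  maximizing \<open>ln |M| - Tr M\<close> over \<open>M = L\<^sup>T T L\<close>, whose unique maximizer is \<open>M = I\<close>. The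
  remaining part, in \<open>(\<mu>, \<sigma>\<^sup>2, m\<^sub>f, m\<^sub>h)\<close>, tends to \<open>-\<infinity>\<close> at the boundary of its domain, so it
  attains its maximum, and comparing two maximizers with their midpoint shows that they agree.
  Profiling out \<open>\<xi>\<close> is then legitimate because the observations have separate variational parameters.
\<close>

subsection \<open>The means and the variances\<close>

text \<open>Tychonoff's theorem, in the space of all functions on the index type; hence every index
  carries bounds.\<close>

lemma compact_function_box:
  fixes lo hi :: "'i \<Rightarrow> real"
  shows "compact {f. \<forall>i. lo i \<le> f i \<and> f i \<le> hi i}"
proof -
  have "compactin (product_topology (\<lambda>_. euclidean) UNIV) (PiE UNIV (\<lambda>i. {lo i..hi i}))"
    by (simp add: compactin_PiE)
  moreover have "PiE UNIV (\<lambda>i. {lo i..hi i}) = {f. \<forall>i. lo i \<le> f i \<and> f i \<le> hi i}"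
    by (auto simp: PiE_UNIV_domain Pi_def)
  ultimately show ?thesis
    by (simp add: euclidean_product_topology)
qed

text \<open>Concavity of \<open>ln\<close> is the inequality of arithmetic and geometric means: the
  squared mean exceeds \<open>s * t\<close> by \<open>((s - t) / 2)\<^sup>2\<close>. The equality
  case later identifies the variances.\<close>

lemma ln_midpoint:
  fixes s t :: real
  assumes "s > 0" "t > 0"
  shows "(ln s + ln t) / 2 \<le> ln ((s + t) / 2)"
    and "(ln s + ln t) / 2 = ln ((s + t) / 2) \<Longrightarrow> s = t"
proof -
  define w where "w = (s + t) / 2"
  have w: "w > 0" using assms by (simp add: w_def)
  have 1: "ln s + ln t = ln (s * t)" "2 * ln w = ln (w\<^sup>2)"
    using assms w by (auto simp: ln_mult ln_realpow)
  have 2: "w\<^sup>2 - s * t = ((s - t) / 2)\<^sup>2"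
    by (simp add: w_def power2_eq_square field_simps)
  have "s * t \<le> w\<^sup>2"
    using 2 zero_le_power2[of "(s - t) / 2"] by linarith
  then have "ln (s * t) \<le> ln (w\<^sup>2)" using assms w by (subst ln_le_cancel_iff) auto
  then show "(ln s + ln t) / 2 \<le> ln ((s + t) / 2)" using 1 unfolding w_def[symmetric] by argo
  assume "(ln s + ln t) / 2 = ln ((s + t) / 2)"
  then have "ln (s * t) = ln (w\<^sup>2)" using 1 unfolding w_def[symmetric] by argo
  then have "s * t = w\<^sup>2" using assms w by (subst (asm) ln_inj_iff) auto
  then show "s = t" using 2 by simp
qed

text \<open>Midpoint convexity, from expanding the square of
  \<open>exp (u / 2) - exp (v / 2)\<close>.\<close>

lemma exp_midpoint:
  fixes u v :: real
  shows "exp ((u + v) / 2) \<le> (exp u + exp v) / 2"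
proof -
  have "0 \<le> (exp (u / 2) - exp (v / 2))\<^sup>2" by simp
  also have "\<dots> = exp u + exp v - 2 * exp ((u + v) / 2)"
    by (simp add: power2_eq_square algebra_simps add_divide_distrib flip: exp_add)
  finally show ?thesis by simp
qed

text \<open>For \<open>x > 0\<close> the concave function of \<open>m\<close> peaks where
  \<open>a * exp m = x\<close>. For \<open>x = 0\<close>, a zero count, there is no critical point,
  but the function is negative.\<close>

lemma linear_minus_exp_bounded:
  fixes x a :: real
  assumes "x \<ge> 0" "a > 0"
  obtains D where "\<And>m. x * m - a * exp m \<le> D"
proof (cases "x = 0")
  case True
  then show ?thesis using that[of 0] assms by simp
next
  case False
  define t where "t = ln (x / a)"
  have t: "a * exp t = x" using assms False by (simp add: t_def)
  have "x * m - a * exp m \<le> x * (t - 1)" for m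
  proof -
    have "a * exp m = x * exp (m - t)"
      using t by (simp add: exp_diff field_simps)
    \<comment> \<open>The tangent line of the exponential at the critical point \<open>t\<close>
      gives the bound.\<close>
    moreover have "x * (1 + (m - t)) \<le> x * exp (m - t)"
      using assms exp_ge_add_one_self by (intro mult_left_mono) auto
    ultimately show ?thesis by (simp add: algebra_simps)
  qed
  then show ?thesis by (rule that)
qed

text \<open>
  Here \<open>m\<close> and \<open>s\<close> are \<open>\<mu>\<close> and \<open>\<sigma>\<^sup>2\<close>, \<open>b j\<close> is \<open>z\<^sup>T \<beta>\<^sub>j\<close>, and \<open>u\<close> and \<open>C j\<close> are the factor means and
  loadings, the shared factors stacked on the study-specific ones.
\<close>

locale latent_objective =
  fixes J :: "'j set" and K :: "'k set"
    and a l :: real and x b :: "'j \<Rightarrow> real" and C :: "'j \<Rightarrow> 'k \<Rightarrow> real"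
  assumes finite: "finite J" "finite K"
    and a_pos: "a > 0" and l_pos: "l > 0" and x_nonneg: "\<And>j. x j \<ge> 0"
begin

definition resid :: "('j \<Rightarrow> real) \<Rightarrow> ('k \<Rightarrow> real) \<Rightarrow> 'j \<Rightarrow> real" where
  "resid m u j = m j - b j - (\<Sum>k\<in>K. C j k * u k)"

text \<open>Up to constants: the expected Poisson log-likelihood of one variable, its expected
  Gaussian log-density, and the entropy \<open>ln (s j) / 2\<close> of its variational factor. The
  terms with factor covariances are left out.\<close>

definition summand :: "('j \<Rightarrow> real) \<Rightarrow> ('j \<Rightarrow> real) \<Rightarrow> ('k \<Rightarrow> real) \<Rightarrow> 'j \<Rightarrow> real" where
  "summand m s u j = x j * m j - a * exp (m j + s j / 2)
     - (resid m u j)\<^sup>2 / (2 * l) - s j / (2 * l) + ln (s j) / 2"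

definition objective :: "('j \<Rightarrow> real) \<Rightarrow> ('j \<Rightarrow> real) \<Rightarrow> ('k \<Rightarrow> real) \<Rightarrow> real" where
  "objective m s u = (\<Sum>j\<in>J. summand m s u j) - (\<Sum>k\<in>K. (u k)\<^sup>2) / 2"

text \<open>The arguments are total functions, but only their values on \<open>J\<close> and
  \<open>K\<close> count. They may therefore be reset elsewhere, and uniqueness can only mean
  agreement on these sets.\<close>

lemma objective_cong:
  assumes "\<And>j. j \<in> J \<Longrightarrow> m j = m' j" "\<And>j. j \<in> J \<Longrightarrow> s j = s' j" "\<And>k. k \<in> K \<Longrightarrow> u k = u' k"
  shows "objective m s u = objective m' s' u'"
  using assms by (simp add: objective_def summand_def resid_def cong: sum.cong)

section \<open>Strict concavity and uniqueness\<close>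

lemma resid_midpoint:
  "resid (\<lambda>j. (m j + m' j) / 2) (\<lambda>k. (u k + u' k) / 2) j = (resid m u j + resid m' u' j) / 2"
proof -
  have "(\<Sum>k\<in>K. C j k * ((u k + u' k) / 2)) = ((\<Sum>k\<in>K. C j k * u k) + (\<Sum>k\<in>K. C j k * u' k)) / 2"
    by (simp add: sum_divide_distrib distrib_left add_divide_distrib flip: sum.distrib)
  then show ?thesis by (simp add: resid_def field_simps)
qed

text \<open>The concavity gap is kept explicit so that uniqueness can be read off from it. Squares
  contribute their gap exactly: the midpoint loses a quarter of the squared difference, which the
  weights \<open>1 / (2 * l)\<close> and \<open>1 / 2\<close> turn into the factors
  \<open>1 / (8 * l)\<close> and \<open>1 / 8\<close>. The exponential contributes an inequality by
  convexity.\<close>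

lemma objective_midpoint:
  assumes s: "\<forall>j\<in>J. s j > 0" "\<forall>j\<in>J. s' j > 0"
  shows "(objective m s u + objective m' s' u') / 2
      + (\<Sum>j\<in>J. (resid m u j - resid m' u' j)\<^sup>2 / (8 * l)
               + (ln ((s j + s' j) / 2) - (ln (s j) + ln (s' j)) / 2) / 2)
      + (\<Sum>k\<in>K. (u k - u' k)\<^sup>2 / 8)
    \<le> objective (\<lambda>j. (m j + m' j) / 2) (\<lambda>j. (s j + s' j) / 2) (\<lambda>k. (u k + u' k) / 2)"
    (is "_ + sum ?d J + sum ?e K \<le> objective ?m ?s ?u")
proof -
  have "(summand m s u j + summand m' s' u' j) / 2 + ?d j \<le> summand ?m ?s ?u j" for j
  proof -
    have "(?m j + ?s j / 2) = ((m j + s j / 2) + (m' j + s' j / 2)) / 2" by (simp add: field_simps)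
    then have "exp (?m j + ?s j / 2) \<le> (exp (m j + s j / 2) + exp (m' j + s' j / 2)) / 2"
      using exp_midpoint by metis
    then have "a * exp (?m j + ?s j / 2) \<le> a * ((exp (m j + s j / 2) + exp (m' j + s' j / 2)) / 2)"
      using a_pos by simp
    moreover have "((resid m u j + resid m' u' j) / 2)\<^sup>2 / (2 * l)
        = ((resid m u j)\<^sup>2 / (2 * l) + (resid m' u' j)\<^sup>2 / (2 * l)) / 2
          - (resid m u j - resid m' u' j)\<^sup>2 / (8 * l)"
      using l_pos by (simp add: power2_eq_square field_simps)
    moreover have "x j * ?m j = (x j * m j + x j * m' j) / 2" "?s j / (2 * l) = (s j / (2 * l) + s' j / (2 * l)) / 2"
      by (simp_all add: algebra_simps add_divide_distrib)
    ultimately show ?thesis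
      unfolding summand_def resid_midpoint by (simp add: algebra_simps add_divide_distrib diff_divide_distrib)
  qed
  then have "(\<Sum>j\<in>J. (summand m s u j + summand m' s' u' j) / 2 + ?d j) \<le> (\<Sum>j\<in>J. summand ?m ?s ?u j)"
    by (intro sum_mono)
  then have "(sum (summand m s u) J + sum (summand m' s' u') J) / 2 + sum ?d J \<le> (\<Sum>j\<in>J. summand ?m ?s ?u j)"
    by (simp only: sum.distrib flip: sum_divide_distrib)
  moreover have "(\<Sum>k\<in>K. (?u k)\<^sup>2) / 2 = ((\<Sum>k\<in>K. (u k)\<^sup>2) / 2 + (\<Sum>k\<in>K. (u' k)\<^sup>2) / 2) / 2 - sum ?e K"
  proof -
    have "(?u k)\<^sup>2 = ((u k)\<^sup>2 + (u' k)\<^sup>2) / 2 - 2 * ?e k" for k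
      by (simp add: power2_eq_square field_simps)
    then have "(\<Sum>k\<in>K. (?u k)\<^sup>2) = ((\<Sum>k\<in>K. (u k)\<^sup>2) + (\<Sum>k\<in>K. (u' k)\<^sup>2)) / 2 - 2 * sum ?e K"
      by (simp only: sum_subtractf sum.distrib flip: sum_divide_distrib sum_distrib_left)
    then show ?thesis by argo
  qed
  ultimately show ?thesis
    unfolding objective_def by argo
qed

text \<open>The midpoint of two maximizers cannot exceed the maximum, so every nonnegative term of
  the concavity gap vanishes.\<close>

lemma objective_max_unique:
  assumes s: "\<forall>j\<in>J. s j > 0" "\<forall>j\<in>J. s' j > 0"
    and max: "\<And>m'' s'' u''. \<forall>j\<in>J. s'' j > 0 \<Longrightarrow> objective m'' s'' u'' \<le> objective m s u"
    and eq: "objective m' s' u' = objective m s u"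
  shows "(\<forall>j\<in>J. m j = m' j \<and> s j = s' j) \<and> (\<forall>k\<in>K. u k = u' k)"
proof -
  define d where "d j = (resid m u j - resid m' u' j)\<^sup>2 / (8 * l)
      + (ln ((s j + s' j) / 2) - (ln (s j) + ln (s' j)) / 2) / 2" for j
  define e where "e k = (u k - u' k)\<^sup>2 / 8" for k
  have ln: "0 \<le> ln ((s j + s' j) / 2) - (ln (s j) + ln (s' j)) / 2" if "j \<in> J" for j
    using ln_midpoint(1)[of "s j" "s' j"] s that by simp
  have d: "0 \<le> d j" if "j \<in> J" for j
    using ln[OF that] l_pos unfolding d_def by (intro add_nonneg_nonneg) auto
  have e: "0 \<le> e k" for k by (simp add: e_def)
  have "objective (\<lambda>j. (m j + m' j) / 2) (\<lambda>j. (s j + s' j) / 2) (\<lambda>k. (u k + u' k) / 2)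
      \<le> objective m s u"
    using s by (intro max) (simp add: add_pos_pos)
  with objective_midpoint[OF s, where m = m and m' = m' and u = u and u' = u'] eq have "sum d J + sum e K \<le> 0"
    unfolding d_def e_def by simp
  moreover have "0 \<le> sum d J" "0 \<le> sum e K" using d e by (auto intro: sum_nonneg)
  ultimately have "sum d J = 0" "sum e K = 0" by linarith+
  then have d0: "\<And>j. j \<in> J \<Longrightarrow> d j = 0" and e0: "\<And>k. k \<in> K \<Longrightarrow> e k = 0"
    using d e finite by (auto simp: sum_nonneg_eq_0_iff)
  have u: "u k = u' k" if "k \<in> K" for k using e0[OF that] by (simp add: e_def)
  have "m j = m' j \<and> s j = s' j" if j: "j \<in> J" for j
  proof -
    have "0 \<le> (resid m u j - resid m' u' j)\<^sup>2 / (8 * l)" using l_pos by simp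
    with d0[OF j] ln[OF j] have "(resid m u j - resid m' u' j)\<^sup>2 / (8 * l) = 0"
      and l0: "(ln (s j) + ln (s' j)) / 2 = ln ((s j + s' j) / 2)"
      unfolding d_def by argo+
    \<comment> \<open>The residual mixes \<open>m\<close> and \<open>u\<close>; as \<open>u\<close>
      and \<open>u'\<close> already agree on \<open>K\<close>, equal residuals give equal
      means.\<close>
    then have "resid m u j = resid m' u' j" using l_pos by simp
    moreover have "(\<Sum>k\<in>K. C j k * u k) = (\<Sum>k\<in>K. C j k * u' k)" using u by simp
    ultimately show ?thesis using ln_midpoint(2)[OF _ _ l0] s j by (simp add: resid_def)
  qed
  then show ?thesis using u by blast
qed

section \<open>Coercivity and existence\<close>

text \<open>Coercivity: the shortfall of the objective below \<open>T\<close> controls every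
  coordinate. The logarithmic bound keeps the variances away from 0, the boundary of the open
  domain.\<close>

lemma objective_bounds:
  obtains T where
    "\<And>m s u j. \<forall>j\<in>J. s j > 0 \<Longrightarrow> j \<in> J \<Longrightarrow>
       (resid m u j)\<^sup>2 \<le> 2 * l * (T - objective m s u) \<and>
       s j \<le> 4 * l * (T - objective m s u) \<and> - 2 * (T - objective m s u) \<le> ln (s j)"
    "\<And>m s u k. \<forall>j\<in>J. s j > 0 \<Longrightarrow> k \<in> K \<Longrightarrow> (u k)\<^sup>2 \<le> 2 * (T - objective m s u)"
    "\<And>m s u. \<forall>j\<in>J. s j > 0 \<Longrightarrow> objective m s u \<le> T"
proof -
  have "\<forall>j. \<exists>D. \<forall>m. x j * m - a * exp m \<le> D"
    using linear_minus_exp_bounded[OF x_nonneg a_pos] by metis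
  then obtain D where D: "\<And>j m. x j * m - a * exp m \<le> D j" by metis
  \<comment> \<open>\<open>P j\<close> bounds the summand of \<open>j\<close>: \<open>D j\<close>
    covers the Poisson part, the other term the constant left over when \<open>ln (s j) / 2\<close>
    is absorbed.\<close>
  define P where "P j = \<bar>D j\<bar> + \<bar>ln (2 * l)\<bar> / 2" for j
  define T where "T = sum P J"
  have bound: "summand m s u j \<le> P j - (resid m u j)\<^sup>2 / (2 * l) - s j / (4 * l)"
    "summand m s u j \<le> P j + ln (s j) / 2"
    "summand m s u j \<le> P j" if s: "s j > 0" for m s u j
  proof -
    have "exp (m j) \<le> exp (m j + s j / 2)" using s by simp
    then have "a * exp (m j) \<le> a * exp (m j + s j / 2)" using a_pos by simp
    then have 1: "x j * m j - a * exp (m j + s j / 2) \<le> \<bar>D j\<bar>"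
      using D[of j "m j"] by linarith
    \<comment> \<open>The logarithm is linearized at the scale \<open>2 * l\<close>, so that
      \<open>ln (s j) / 2\<close> uses up exactly half of the penalty \<open>s j / (2 * l)\<close>;
      the other half bounds the variance.\<close>
    have "ln (s j / (2 * l)) \<le> s j / (2 * l) - 1"
      using s l_pos by (intro ln_le_minus_one) auto
    then have 2: "ln (s j) \<le> s j / (2 * l) + \<bar>ln (2 * l)\<bar>"
      using s l_pos by (simp add: ln_div)
    have 3: "s j / (2 * l) = 2 * (s j / (4 * l))" by simp
    have 4: "0 \<le> (resid m u j)\<^sup>2 / (2 * l)" "0 \<le> s j / (4 * l)" using s l_pos by auto
    show "summand m s u j \<le> P j - (resid m u j)\<^sup>2 / (2 * l) - s j / (4 * l)"
      "summand m s u j \<le> P j + ln (s j) / 2"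
      "summand m s u j \<le> P j"
      using 1 2 3 4 unfolding summand_def P_def by argo+
  qed
  \<comment> \<open>All summands except that of \<open>j\<close> are replaced by their upper bounds,
    so the shortfall of this one summand is at most that of the objective.\<close>
  have split: "objective m s u \<le> T + (summand m s u j - P j)" if s: "\<forall>j\<in>J. s j > 0" and j: "j \<in> J" for m s u j
  proof -
    have "(\<Sum>i\<in>J. summand m s u i) = summand m s u j + (\<Sum>i\<in>J-{j}. summand m s u i)"
      using j finite by (simp add: sum.remove)
    also have "(\<Sum>i\<in>J-{j}. summand m s u i) \<le> (\<Sum>i\<in>J-{j}. P i)"
      using s bound(3) by (intro sum_mono) auto
    also have "(\<Sum>i\<in>J-{j}. P i) = T - P j"
      using j finite by (simp add: T_def sum.remove)
    finally have "(\<Sum>i\<in>J. summand m s u i) \<le> T + (summand m s u j - P j)" by simp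
    moreover have "0 \<le> (\<Sum>k\<in>K. (u k)\<^sup>2)" by (simp add: sum_nonneg)
    ultimately show ?thesis unfolding objective_def by linarith
  qed
  have all: "(\<Sum>i\<in>J. summand m s u i) \<le> T" if s: "\<forall>j\<in>J. s j > 0" for m s u
    unfolding T_def using s bound(3) by (intro sum_mono) auto
  show ?thesis
  proof
    fix m s :: "'j \<Rightarrow> real" and u :: "'k \<Rightarrow> real" and j
    assume s: "\<forall>j\<in>J. s j > 0" and j: "j \<in> J"
    let ?W = "T - objective m s u "
    have 4: "0 \<le> (resid m u j)\<^sup>2 / (2 * l)" "0 \<le> s j / (4 * l)" using bspec[OF s j] l_pos by auto
    have "(resid m u j)\<^sup>2 / (2 * l) \<le> ?W" "s j / (4 * l) \<le> ?W" "- 2 * ?W \<le> ln (s j)"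
      using split[OF s j, of m u] bound[of s j m u, OF bspec[OF s j]] 4 by argo+
    then show "(resid m u j)\<^sup>2 \<le> 2 * l * ?W \<and> s j \<le> 4 * l * ?W \<and> - 2 * ?W \<le> ln (s j)"
      using l_pos by (simp add: field_simps)
  next
    fix m s :: "'j \<Rightarrow> real" and u :: "'k \<Rightarrow> real" and k
    assume s: "\<forall>j\<in>J. s j > 0" and k: "k \<in> K"
    have "(u k)\<^sup>2 \<le> (\<Sum>k\<in>K. (u k)\<^sup>2)"
      using k finite by (intro member_le_sum) auto
    then show "(u k)\<^sup>2 \<le> 2 * (T - objective m s u)"
      using all[OF s, where m = m and u = u] unfolding objective_def by argo
  next
    fix m s :: "'j \<Rightarrow> real" and u :: "'k \<Rightarrow> real"
    assume s: "\<forall>j\<in>J. s j > 0"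
    have "0 \<le> (\<Sum>k\<in>K. (u k)\<^sup>2)" by (simp add: sum_nonneg)
    then show "objective m s u \<le> T" using all[OF s, where m = m and u = u] unfolding objective_def by argo
  qed
qed

text \<open>By coercivity, any point at least as good as a fixed reference point can be moved into a
  compact box without changing its value, and there a continuous function attains its
  maximum.\<close>

lemma objective_max_exists:
  obtains m s u where "\<forall>j\<in>J. s j > 0"
    "\<And>m' s' u'. \<forall>j\<in>J. s' j > 0 \<Longrightarrow> objective m' s' u' \<le> objective m s u"
proof -
  obtain T where
    T: "\<And>m s u j. \<forall>j\<in>J. s j > 0 \<Longrightarrow> j \<in> J \<Longrightarrow>
       (resid m u j)\<^sup>2 \<le> 2 * l * (T - objective m s u) \<and>
       s j \<le> 4 * l * (T - objective m s u) \<and> - 2 * (T - objective m s u) \<le> ln (s j)"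
    "\<And>m s u k. \<forall>j\<in>J. s j > 0 \<Longrightarrow> k \<in> K \<Longrightarrow> (u k)\<^sup>2 \<le> 2 * (T - objective m s u)"
    "\<And>m s u. \<forall>j\<in>J. s j > 0 \<Longrightarrow> objective m s u \<le> T"
    using objective_bounds by metis
  \<comment> \<open>The reference point is \<open>m = 0\<close>, \<open>s = 1\<close>,
    \<open>u = 0\<close>; its components also serve as default values outside \<open>J\<close> and
    \<open>K\<close>.\<close>
  define V where "V = objective (\<lambda>_. 0) (\<lambda>_. 1) (\<lambda>_. 0)"
  define W where "W = T - V"
  have W: "0 \<le> W" using T(3)[where s = "\<lambda>_. 1" and m = "\<lambda>_. 0" and u = "\<lambda>_. 0"] by (simp add: W_def V_def)
  \<comment> \<open>The radii come from the coercivity bounds with shortfall \<open>W\<close>. A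
    bound \<open>w\<close> on a square gives \<open>1 + w\<close> for the absolute value, and
    \<open>m j\<close> is recovered from its residual, \<open>b j\<close> and the loadings. The 1 in
    \<open>Rs\<close> makes room for the default variance.\<close>
  define Ru where "Ru = 1 + 2 * W"
  define Rm where "Rm j = 1 + 2 * l * W + \<bar>b j\<bar> + (\<Sum>k\<in>K. \<bar>C j k\<bar> * Ru)" for j
  define Rs where "Rs = 1 + 4 * l * W"
  have Ru: "0 \<le> Ru" using W by (simp add: Ru_def)
  have Rm: "0 \<le> Rm j" for j
    using W l_pos Ru unfolding Rm_def by (intro add_nonneg_nonneg sum_nonneg) auto
  have Rs: "1 \<le> Rs" using W l_pos by (simp add: Rs_def)
  define Bm where "Bm = {f. \<forall>i. - Rm i \<le> f i \<and> f i \<le> Rm i}"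
  define Bs :: "('j \<Rightarrow> real) set" where "Bs = {f. \<forall>i. exp (- 2 * W) \<le> f i \<and> f i \<le> Rs}"
  define Bu :: "('k \<Rightarrow> real) set" where "Bu = {f. \<forall>i. - Ru \<le> f i \<and> f i \<le> Ru}"
  have sqrt_bound: "\<bar>r\<bar> \<le> 1 + w" if "r\<^sup>2 \<le> w" for r w :: real
  proof -
    have "0 \<le> (\<bar>r\<bar> - 1)\<^sup>2" by simp
    then have "2 * \<bar>r\<bar> \<le> 1 + r\<^sup>2" by (simp add: power2_eq_square algebra_simps)
    then show ?thesis using that zero_le_power2[of r] by linarith
  qed
  have V_le: "\<exists>m'\<in>Bm. \<exists>s'\<in>Bs. \<exists>u'\<in>Bu. objective m' s' u' = objective m s u"
    if s: "\<forall>j\<in>J. s j > 0" and V: "V \<le> objective m s u" for m s u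
  proof -
    have le: "T - objective m s u \<le> W" using V by (simp add: W_def)
    have u: "\<bar>u k\<bar> \<le> Ru" if "k \<in> K" for k
    proof -
      have "(u k)\<^sup>2 \<le> 2 * W" using T(2)[OF s that, where m = m and u = u] le by argo
      then show ?thesis unfolding Ru_def by (rule sqrt_bound)
    qed
    have m: "\<bar>m j\<bar> \<le> Rm j" if j: "j \<in> J" for j
    proof -
      have "2 * l * (T - objective m s u) \<le> 2 * l * W" using le l_pos by simp
      then have "(resid m u j)\<^sup>2 \<le> 2 * l * W" using T(1)[OF s j, where m = m and u = u] by linarith
      then have r: "\<bar>resid m u j\<bar> \<le> 1 + 2 * l * W" by (rule sqrt_bound)
      have "\<bar>\<Sum>k\<in>K. C j k * u k\<bar> \<le> (\<Sum>k\<in>K. \<bar>C j k * u k\<bar>)" by (rule sum_abs)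
      also have "\<dots> \<le> (\<Sum>k\<in>K. \<bar>C j k\<bar> * Ru)"
        using u by (intro sum_mono) (auto simp: abs_mult intro: mult_left_mono)
      finally show ?thesis using r unfolding resid_def Rm_def by linarith
    qed
    have sb: "exp (- 2 * W) \<le> s j \<and> s j \<le> Rs" if j: "j \<in> J" for j
    proof -
      have "4 * l * (T - objective m s u) \<le> 4 * l * W" using le l_pos by simp
      then have "s j \<le> Rs" using T(1)[OF s j, where m = m and u = u] unfolding Rs_def by linarith
      moreover have "- 2 * W \<le> ln (s j)" using T(1)[OF s j, where m = m and u = u] le by argo
      then have "exp (- 2 * W) \<le> s j" using bspec[OF s j] by (simp add: ln_ge_iff)
      ultimately show ?thesis by simp
    qed
    show ?thesis
    \<comment> \<open>Resetting the coordinates outside \<open>J\<close> and \<open>K\<close> places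
      the functions in the boxes. The default variance is 1 since 0 lies below
      \<open>exp (- 2 * W)\<close>.\<close>
    proof (intro bexI)
      show "objective (\<lambda>j. if j \<in> J then m j else 0) (\<lambda>j. if j \<in> J then s j else 1)
          (\<lambda>k. if k \<in> K then u k else 0) = objective m s u"
        by (rule objective_cong) auto
      show "(\<lambda>j. if j \<in> J then m j else 0) \<in> Bm"
        using m Rm by (fastforce simp: Bm_def abs_le_iff)
      show "(\<lambda>j. if j \<in> J then s j else 1) \<in> Bs"
        using sb Rs W by (auto simp: Bs_def)
      show "(\<lambda>k. if k \<in> K then u k else 0) \<in> Bu"
        using u Ru by (fastforce simp: Bu_def abs_le_iff)
    qed
  qed
  define F where "F = (\<lambda>(m, s, u). objective m s u)"
  have compact: "compact (Bm \<times> Bs \<times> Bu)"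
    unfolding Bm_def Bs_def Bu_def by (intro compact_Times compact_function_box)
  have "(\<lambda>_. 0) \<in> Bm" "(\<lambda>_. 1) \<in> Bs" "(\<lambda>_. 0) \<in> Bu"
    using W Rm Rs Ru by (auto simp: Bm_def Bs_def Bu_def)
  then have in_box: "((\<lambda>_. 0), (\<lambda>_. 1), (\<lambda>_. 0)) \<in> Bm \<times> Bs \<times> Bu" by simp
  have Bs_pos: "0 < f j" if "f \<in> Bs" for f j
  proof -
    have "exp (- 2 * W) \<le> f j" using that by (simp add: Bs_def)
    then show ?thesis by (rule less_le_trans[OF exp_gt_zero])
  qed
  have coord: "continuous_on A (\<lambda>y. fst y j)" "continuous_on A (\<lambda>y. fst (snd y) j)"
    "continuous_on A (\<lambda>y. snd (snd y) k)"
    for A :: "(('j \<Rightarrow> real) \<times> ('j \<Rightarrow> real) \<times> ('k \<Rightarrow> real)) set" and j k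
    by (rule continuous_on_product_then_coordinatewise, intro continuous_intros)+
  \<comment> \<open>In the product topology each coordinate is continuous; the positive lower bound
    in \<open>Bs\<close> makes the logarithm continuous on the box.\<close>
  have "continuous_on (Bm \<times> Bs \<times> Bu)
      (\<lambda>y. objective (fst y) (fst (snd y)) (snd (snd y)))"
    unfolding objective_def summand_def resid_def
    by (intro continuous_on_diff continuous_on_add continuous_on_sum continuous_on_mult
        continuous_on_exp continuous_on_power continuous_on_divide continuous_on_ln
        continuous_on_const coord) (use l_pos Bs_pos in \<open>auto simp: less_imp_neq[THEN not_sym]\<close>)
  then have cont: "continuous_on (Bm \<times> Bs \<times> Bu) F"
    by (simp add: F_def case_prod_beta')
  obtain y where y: "y \<in> Bm \<times> Bs \<times> Bu" "\<And>y'. y' \<in> Bm \<times> Bs \<times> Bu \<Longrightarrow> F y' \<le> F y"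
    using continuous_attains_sup[OF compact _ cont] in_box by blast
  obtain m s u where msu: "y = (m, s, u)" by (cases y)
  show ?thesis
  proof
    show "\<forall>j\<in>J. s j > 0" using y(1) Bs_pos by (auto simp: msu)
    fix m' s' :: "'j \<Rightarrow> real" and u' :: "'k \<Rightarrow> real"
    assume s': "\<forall>j\<in>J. s' j > 0"
    show "objective m' s' u' \<le> objective m s u"
    \<comment> \<open>A point worse than the reference point is beaten by the latter, which lies in
      the box; any other point has a representative there.\<close>
    proof (cases "V \<le> objective m' s' u'")
      case True
      from V_le[OF s' this] obtain m'' s'' u'' where "m'' \<in> Bm" "s'' \<in> Bs" "u'' \<in> Bu"
        "objective m'' s'' u'' = objective m' s' u'" by blast
      then show ?thesis using y(2)[of "(m'', s'', u'')"] by (simp add: F_def msu)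
    next
      case False
      then show ?thesis using y(2)[OF in_box] by (simp add: F_def msu V_def)
    qed
  qed
qed

end

subsection \<open>The factor covariances\<close>

lemma pos_def_matsD:
  assumes "M \<in> pos_def_mats k"
  shows "M \<in> carrier_mat k k" "transpose_mat M = M"
    "\<And>i j. i < k \<Longrightarrow> j < k \<Longrightarrow> M $$ (i, j) = M $$ (j, i)"
    "\<And>v. v \<in> carrier_vec k \<Longrightarrow> v \<noteq> 0\<^sub>v k \<Longrightarrow> v \<bullet> (M *\<^sub>v v) > 0"
proof -
  show 1: "M \<in> carrier_mat k k" "transpose_mat M = M"
    "\<And>v. v \<in> carrier_vec k \<Longrightarrow> v \<noteq> 0\<^sub>v k \<Longrightarrow> v \<bullet> (M *\<^sub>v v) > 0"
    using assms by (auto simp: pos_def_mats_def)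
  show "M $$ (i, j) = M $$ (j, i)" if "i < k" "j < k" for i j
    using 1(1,2) that by (metis carrier_matD index_transpose_mat(1))
qed

lemma pos_def_matsI:
  assumes "M \<in> carrier_mat k k"
    "\<And>i j. i < k \<Longrightarrow> j < k \<Longrightarrow> M $$ (i, j) = M $$ (j, i)"
    "\<And>v. v \<in> carrier_vec k \<Longrightarrow> v \<noteq> 0\<^sub>v k \<Longrightarrow> v \<bullet> (M *\<^sub>v v) > 0"
  shows "M \<in> pos_def_mats k"
proof -
  have "transpose_mat M = M" using assms(1,2) by (intro eq_matI) auto
  then show ?thesis using assms by (simp add: pos_def_mats_def)
qed

lemma quadratic_form_sum:
  fixes M :: "real mat"
  assumes "M \<in> carrier_mat k k" "v \<in> carrier_vec k"
  shows "v \<bullet> (M *\<^sub>v v) = (\<Sum>i<k. \<Sum>j<k. v $ i * M $$ (i, j) * v $ j)"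
  proof -
  have "(M *\<^sub>v v) $ i = (\<Sum>j<k. M $$ (i, j) * v $ j)" if "i < k" for i
    using assms that by (simp add: scalar_prod_def lessThan_atLeast0)
  then show ?thesis
    using assms by (simp add: scalar_prod_def lessThan_atLeast0 sum_distrib_left mult.assoc)
qed

lemma self_scalar_prod_pos:
  fixes v :: "real vec"
  assumes "v \<in> carrier_vec k" "v \<noteq> 0\<^sub>v k"
  shows "0 < v \<bullet> v"
proof -
  obtain i where i: "i < k" "v $ i \<noteq> 0" using assms by (metis carrier_vecD eq_vecI index_zero_vec)
  have "0 < (v $ i)\<^sup>2" using i by simp
  also have "\<dots> \<le> (\<Sum>j\<in>{0..<k}. (v $ j)\<^sup>2)" using i by (intro member_le_sum) auto
  also have "\<dots> = v \<bullet> v" using assms by (simp add: scalar_prod_def power2_eq_square)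
  finally show ?thesis .
qed

text \<open>Induction on the dimension: split off the first row and column and factor the Schur
  complement of the corner entry, which is again positive definite.\<close>

lemma cholesky:
  assumes "M \<in> pos_def_mats k"
  obtains L where "L \<in> carrier_mat k k" "\<And>i j. i < j \<Longrightarrow> j < k \<Longrightarrow> L $$ (i, j) = 0"
    "\<And>i. i < k \<Longrightarrow> 0 < L $$ (i, i)" "M = L * transpose_mat L"
proof -
  have "\<exists>L\<in>carrier_mat k k. (\<forall>i j. i < j \<longrightarrow> j < k \<longrightarrow> L $$ (i, j) = 0) \<and>
      (\<forall>i<k. 0 < L $$ (i, i)) \<and> M = L * transpose_mat L"
    using assms
  proof (induction k arbitrary: M)
    case 0
    then have "M \<in> carrier_mat 0 0" by (rule pos_def_matsD)
    then show ?case by (intro bexI[of _ "1\<^sub>m 0"]) auto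
  next
    case (Suc k)
    note M = pos_def_matsD[OF Suc.prems]
    define a where "a = M $$ (0, 0)"
    define b where "b i = M $$ (Suc i, 0)" for i
    have b': "M $$ (0, Suc i) = b i" if "i < k" for i
      using M(3)[of 0 "Suc i"] that by (simp add: b_def)
    have expand: "w \<bullet> (M *\<^sub>v w) = a * (w $ 0)\<^sup>2 + 2 * w $ 0 * (\<Sum>i<k. b i * w $ Suc i)
        + (\<Sum>i<k. \<Sum>j<k. w $ Suc i * M $$ (Suc i, Suc j) * w $ Suc j)"
      if "w \<in> carrier_vec (Suc k)" for w
    proof -
      have "w \<bullet> (M *\<^sub>v w) = w $ 0 * a * w $ 0 + (\<Sum>j<k. w $ 0 * b j * w $ Suc j)
          + ((\<Sum>i<k. w $ Suc i * b i * w $ 0)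
             + (\<Sum>i<k. \<Sum>j<k. w $ Suc i * M $$ (Suc i, Suc j) * w $ Suc j))"
        unfolding quadratic_form_sum[OF M(1) that] sum.lessThan_Suc_shift
        by (simp add: a_def b' sum.distrib flip: b_def)
      also have "(\<Sum>j<k. w $ 0 * b j * w $ Suc j) = w $ 0 * (\<Sum>i<k. b i * w $ Suc i)"
        by (simp add: sum_distrib_left mult_ac)
      also have "(\<Sum>i<k. w $ Suc i * b i * w $ 0) = w $ 0 * (\<Sum>i<k. b i * w $ Suc i)"
        by (simp add: sum_distrib_left mult_ac)
      finally show ?thesis by (simp add: power2_eq_square algebra_simps)
    qed
    have a: "0 < a"
    proof -
      let ?e = "unit_vec (Suc k) 0 :: real vec"
      have "?e $ 0 \<noteq> 0\<^sub>v (Suc k) $ 0" by simp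
      then have "?e \<noteq> 0\<^sub>v (Suc k)" by metis
      then have "0 < ?e \<bullet> (M *\<^sub>v ?e)" by (intro M(4)) auto
      then show ?thesis by (simp add: expand)
    qed
    \<comment> \<open>The Schur complement of the pivot \<open>a\<close>.\<close>
    define C where "C = mat k k (\<lambda>(i, j). M $$ (Suc i, Suc j) - b i * b j / a)"
    have C: "C \<in> carrier_mat k k" by (simp add: C_def)
    have "C \<in> pos_def_mats k"
    proof (rule pos_def_matsI[OF C])
      show "C $$ (i, j) = C $$ (j, i)" if "i < k" "j < k" for i j
        using that M(3)[of "Suc i" "Suc j"] by (simp add: C_def)
      fix v :: "real vec" assume v: "v \<in> carrier_vec k" "v \<noteq> 0\<^sub>v k"
      define \<beta> where "\<beta> = (\<Sum>i<k. b i * v $ i)"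
      \<comment> \<open>The first coordinate \<open>- \<beta> / a\<close> minimizes the form of
        \<open>M\<close> among the extensions of \<open>v\<close>; the minimum is the value of the
        form of \<open>C\<close> at \<open>v\<close>.\<close>
      define w where "w = vec (Suc k) (\<lambda>i. case i of 0 \<Rightarrow> - \<beta> / a | Suc i \<Rightarrow> v $ i)"
      have w: "w \<in> carrier_vec (Suc k)" "w $ 0 = - \<beta> / a" "\<And>i. i < k \<Longrightarrow> w $ Suc i = v $ i"
        by (simp_all add: w_def)
      have "w \<noteq> 0\<^sub>v (Suc k)"
      proof
        assume "w = 0\<^sub>v (Suc k)"
        then have "v $ i = 0" if "i < k" for i using w(3)[OF that] that by simp
        then have "v = 0\<^sub>v k" using v(1) by (intro eq_vecI) auto
        then show False using v by simp
      qed
      then have "0 < w \<bullet> (M *\<^sub>v w)" using M(4) w(1) by blast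
      also have "\<dots> = (\<Sum>i<k. \<Sum>j<k. v $ i * M $$ (Suc i, Suc j) * v $ j) - \<beta> * \<beta> / a"
        using a by (simp add: expand w \<beta>_def[symmetric] power2_eq_square field_simps)
      also have "\<beta> * \<beta> / a = (\<Sum>i<k. \<Sum>j<k. v $ i * (b i * b j / a) * v $ j)"
        by (simp add: \<beta>_def sum_product sum_divide_distrib mult_ac)
      also have "(\<Sum>i<k. \<Sum>j<k. v $ i * M $$ (Suc i, Suc j) * v $ j) - \<dots> = v \<bullet> (C *\<^sub>v v)"
        unfolding quadratic_form_sum[OF C v(1)]
        by (simp add: C_def algebra_simps flip: sum_subtractf)
      finally show "0 < v \<bullet> (C *\<^sub>v v)" .
    qed
    then obtain L where L: "L \<in> carrier_mat k k" "\<And>i j. i < j \<Longrightarrow> j < k \<Longrightarrow> L $$ (i, j) = 0"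
      "\<And>i. i < k \<Longrightarrow> 0 < L $$ (i, i)" "C = L * transpose_mat L"
      using Suc.IH by blast
    have LL: "(\<Sum>m<k. L $$ (i, m) * L $$ (j, m)) = M $$ (Suc i, Suc j) - b i * b j / a"
      if "i < k" "j < k" for i j
    proof -
      have "(L * transpose_mat L) $$ (i, j) = M $$ (Suc i, Suc j) - b i * b j / a"
        using that by (simp add: C_def flip: L(4))
      then show ?thesis using that L(1) by (simp add: scalar_prod_def lessThan_atLeast0)
    qed
    \<comment> \<open>In blocks, \<open>R\<close> has first row \<open>sqrt a\<close>, 0 and below
      it \<open>b / sqrt a\<close>, \<open>L\<close>. In \<open>R * transpose_mat R\<close> the
      product of the \<open>b\<close> entries restores what the Schur complement subtracted.\<close>
    define R where "R = mat (Suc k) (Suc k) (\<lambda>(i, j). case i of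
        0 \<Rightarrow> (case j of 0 \<Rightarrow> sqrt a | Suc _ \<Rightarrow> 0)
      | Suc i' \<Rightarrow> (case j of 0 \<Rightarrow> b i' / sqrt a | Suc j' \<Rightarrow> L $$ (i', j')))"
    have R: "R \<in> carrier_mat (Suc k) (Suc k)" by (simp add: R_def)
    have R_index: "R $$ (0, 0) = sqrt a" "\<And>j. j < k \<Longrightarrow> R $$ (0, Suc j) = 0"
      "\<And>i. i < k \<Longrightarrow> R $$ (Suc i, 0) = b i / sqrt a"
      "\<And>i j. i < k \<Longrightarrow> j < k \<Longrightarrow> R $$ (Suc i, Suc j) = L $$ (i, j)"
      by (simp_all add: R_def)
    have "M = R * transpose_mat R"
    proof (rule eq_matI)
      fix i j assume "i < dim_row (R * transpose_mat R)" "j < dim_col (R * transpose_mat R)"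
      then have ij: "i < Suc k" "j < Suc k" using R by auto
      then have "(R * transpose_mat R) $$ (i, j) = (\<Sum>m<Suc k. R $$ (i, m) * R $$ (j, m))"
        using R by (simp add: scalar_prod_def lessThan_atLeast0 del: sum.op_ivl_Suc)
      also have "\<dots> = R $$ (i, 0) * R $$ (j, 0) + (\<Sum>m<k. R $$ (i, Suc m) * R $$ (j, Suc m))"
        by (rule sum.lessThan_Suc_shift)
      also have "\<dots> = M $$ (i, j)"
        using ij a b' by (cases i; cases j) (simp_all add: R_index LL a_def[symmetric] flip: b_def)
      finally show "M $$ (i, j) = (R * transpose_mat R) $$ (i, j)" ..
    qed (use M(1) R in auto)
    moreover have "R $$ (i, j) = 0" if "i < j" "j < Suc k" for i j
      using that L(2) by (cases i; cases j) (auto simp: R_index)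
    moreover have "0 < R $$ (i, i)" if "i < Suc k" for i
      using that L(3) a by (cases i) (auto simp: R_index)
    ultimately show ?case using R by blast
  qed
  then show ?thesis using that by blast
qed

section \<open>The log-determinant against the trace\<close>

text \<open>The determinant is the square of that of the Cholesky factor, a product of positive
  diagonal entries.\<close>

lemma det_pos_def:
  assumes "M \<in> pos_def_mats k"
  shows "0 < det M"
proof -
  obtain L where L: "L \<in> carrier_mat k k" "\<And>i j. i < j \<Longrightarrow> j < k \<Longrightarrow> L $$ (i, j) = 0"
    "\<And>i. i < k \<Longrightarrow> 0 < L $$ (i, i)" "M = L * transpose_mat L"
    using cholesky[OF assms] by blast
  have "det L = (\<Prod>i = 0..<k. L $$ (i, i))"
    using det_lower_triangular[OF L(2) L(1)] L(1) by (simp add: prod_list_diag_prod)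
  then have "det L \<noteq> 0" using L(3) by (simp add: less_imp_neq[symmetric])
  moreover have "det M = det L * det L"
    using L by (simp add: det_mult[of _ k] det_transpose[of _ k])
  ultimately show ?thesis by (metis not_real_square_gt_zero)
qed

text \<open>In terms of the Cholesky factor $L$ of $M$, the difference of the two sides is
  $\sum_i (L_{ii}^2 - 1 - \ln L_{ii}^2) + \sum_{i \neq j} L_{ij}^2$.\<close>

lemma ln_det_less_trace:
  assumes M: "M \<in> pos_def_mats k" and "M \<noteq> 1\<^sub>m k"
  shows "ln (det M) < mat_trace M - real k"
proof -
  obtain L where L: "L \<in> carrier_mat k k" "\<And>i j. i < j \<Longrightarrow> j < k \<Longrightarrow> L $$ (i, j) = 0"
    "\<And>i. i < k \<Longrightarrow> 0 < L $$ (i, i)" "M = L * transpose_mat L"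
    using cholesky[OF M] by blast
  define f where "f i = (L $$ (i, i))\<^sup>2 - 1 - ln ((L $$ (i, i))\<^sup>2)" for i
  define g where "g i = (\<Sum>j\<in>{..<k} - {i}. (L $$ (i, j))\<^sup>2)" for i
  have "det L = (\<Prod>i<k. L $$ (i, i))"
    using det_lower_triangular[OF L(2) L(1)] L(1)
    by (simp add: prod_list_diag_prod lessThan_atLeast0)
  moreover have "det M = det L * det L"
    using L by (simp add: det_mult[of _ k] det_transpose[of _ k])
  ultimately have det_M: "det M = (\<Prod>i<k. (L $$ (i, i))\<^sup>2)"
    by (simp add: power2_eq_square prod.distrib)
  have ln_det: "ln (det M) = (\<Sum>i<k. ln ((L $$ (i, i))\<^sup>2))"
    unfolding det_M using L(3) by (intro ln_prod) (auto simp: less_imp_neq[symmetric])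
  have "mat_trace M = (\<Sum>i<k. \<Sum>j<k. (L $$ (i, j))\<^sup>2)"
    using L(1) by (simp add: L(4) mat_trace_def scalar_prod_def power2_eq_square lessThan_atLeast0)
  also have "\<dots> = (\<Sum>i<k. (L $$ (i, i))\<^sup>2 + g i)"
    unfolding g_def by (intro sum.cong refl sum.remove) auto
  finally have diff: "mat_trace M - real k - ln (det M) = (\<Sum>i<k. f i + g i)"
    by (simp add: ln_det f_def sum.distrib sum_subtractf)
  have f: "0 \<le> f i" if "i < k" for i
    using ln_le_minus_one[of "(L $$ (i, i))\<^sup>2"] L(3)[OF that] by (simp add: f_def)
  have g: "0 \<le> g i" for i by (simp add: g_def sum_nonneg)
  have "\<exists>i<k. f i + g i \<noteq> 0"
  proof (rule ccontr)
    assume "\<not> ?thesis"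
    then have 0: "f i = 0" "g i = 0" if "i < k" for i
      using f g that by (metis add_nonneg_eq_0_iff)+
    have "L $$ (i, j) = (if i = j then 1 else 0)" if ij: "i < k" "j < k" for i j
    proof (cases "i = j")
      case True
      \<comment> \<open>The tangent inequality for \<open>ln\<close> is an equality only at 1;
        positivity of the diagonal then rules out the root -1.\<close>
      have "ln ((L $$ (i, i))\<^sup>2) = (L $$ (i, i))\<^sup>2 - 1" using 0(1)[OF ij(1)] by (simp add: f_def)
      then have "(L $$ (i, i))\<^sup>2 = 1"
        using L(3)[OF ij(1)] by (intro ln_eq_minus_one) auto
      then show ?thesis using True L(3)[OF ij(1)] by (simp add: power2_eq_1_iff)
    next
      case False
      have "(L $$ (i, j))\<^sup>2 \<le> g i"
        unfolding g_def using False ij by (intro member_le_sum) auto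
      then show ?thesis using 0(2)[OF ij(1)] False by simp
    qed
    then have "L = 1\<^sub>m k" using L(1) by (intro eq_matI) auto
    then have "M = 1\<^sub>m k" by (simp add: L(4))
    then show False using assms by simp
  qed
  then obtain i where "i < k" "f i + g i \<noteq> 0" by blast
  then have "0 < (\<Sum>i<k. f i + g i)"
    using f g by (intro sum_pos2[of _ i]) (auto simp: less_le add_nonneg_nonneg)
  then show ?thesis using diff by linarith
qed

lemma mat_trace_comm:
  assumes "A \<in> carrier_mat k m" "B \<in> carrier_mat m k"
  shows "mat_trace (A * B) = mat_trace (B * A)"
proof -
  have "mat_trace (A * B) = (\<Sum>i<k. \<Sum>j<m. A $$ (i, j) * B $$ (j, i))"
    using assms by (simp add: mat_trace_def scalar_prod_def lessThan_atLeast0)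
  also have "\<dots> = (\<Sum>j<m. \<Sum>i<k. B $$ (j, i) * A $$ (i, j))"
    by (subst sum.swap) (simp add: mult.commute)
  also have "\<dots> = mat_trace (B * A)"
    using assms by (simp add: mat_trace_def scalar_prod_def lessThan_atLeast0)
  finally show ?thesis .
qed

text \<open>The form of the product at \<open>v\<close> is the form of \<open>M\<close> at
  \<open>B *\<^sub>v v\<close>, which is nonzero because \<open>B\<close> is invertible.\<close>

lemma congruence_pos_def:
  assumes M: "M \<in> pos_def_mats k" and B: "B \<in> carrier_mat k k" "det B \<noteq> 0"
  shows "transpose_mat B * M * B \<in> pos_def_mats k"
proof -
  note M = pos_def_matsD[OF M]
  let ?N = "transpose_mat B * M * B"
  have "transpose_mat ?N = ?N"
    using M(1,2) B by (simp add: transpose_mult[of _ k k _ k])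
  moreover have "0 < v \<bullet> (?N *\<^sub>v v)" if v: "v \<in> carrier_vec k" "v \<noteq> 0\<^sub>v k" for v
  proof -
    have "B *\<^sub>v v \<noteq> 0\<^sub>v k"
      using det_0_iff_vec_prod_zero_field[OF B(1)] B(2) v by blast
    then have "0 < (B *\<^sub>v v) \<bullet> (M *\<^sub>v (B *\<^sub>v v))" using B v M(4) by auto
    also have "\<dots> = v \<bullet> (transpose_mat B *\<^sub>v (M *\<^sub>v (B *\<^sub>v v)))"
      using transpose_vec_mult_scalar[of "transpose_mat B" k k "M *\<^sub>v (B *\<^sub>v v)" v] B M(1) v
      by auto
    also have "\<dots> = v \<bullet> (?N *\<^sub>v v)"
      using B M(1) v by (simp add: assoc_mult_mat_vec[of _ k k _ k])
    finally show ?thesis .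
  qed
  ultimately show ?thesis
    using M(1) B by (auto simp: pos_def_mats_def)
qed

lemma one_pos_def: "1\<^sub>m k \<in> pos_def_mats k"
  by (auto simp: pos_def_mats_def self_scalar_prod_pos)

text \<open>The maximizer is the inverse of \<open>N\<close>. The strict inequality yields existence
  and uniqueness at once.\<close>

lemma ln_det_minus_trace_max:
  assumes N: "N \<in> pos_def_mats k"
  obtains S where "S \<in> pos_def_mats k"
    "\<And>T. T \<in> pos_def_mats k \<Longrightarrow> T \<noteq> S \<Longrightarrow>
       ln (det T) - mat_trace (T * N) < ln (det S) - mat_trace (S * N)"
proof -
  obtain L where L: "L \<in> carrier_mat k k" "N = L * transpose_mat L"
    using cholesky[OF N] by metis
  have "det N = det L * det L"
    using L by (simp add: det_mult[of _ k] det_transpose[of _ k])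
  then have det_L: "det L \<noteq> 0" using det_pos_def[OF N] by auto
  have "L \<in> Units (ring_mat TYPE(real) k undefined)"
    by (rule det_non_zero_imp_unit[OF L(1) det_L])
  then obtain K where K: "K \<in> carrier_mat k k" "L * K = 1\<^sub>m k" "K * L = 1\<^sub>m k"
    by (auto simp: Units_def ring_mat_simps)
  have "det K * det L = 1" using arg_cong[OF K(3), of det] det_mult[OF K(1) L(1)] by simp
  then have det_K: "det K \<noteq> 0" by auto
  \<comment> \<open>As \<open>K\<close> inverts \<open>L\<close>, this is the inverse of
    \<open>N\<close>, written as a congruence of the identity to show that it is positive
    definite.\<close>
  define S where "S = transpose_mat K * 1\<^sub>m k * K"
  have S: "S \<in> pos_def_mats k" unfolding S_def by (rule congruence_pos_def[OF one_pos_def K(1) det_K])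
  define c where "c T = transpose_mat L * T * L" for T
  have KLT: "transpose_mat K * transpose_mat L = 1\<^sub>m k" "transpose_mat L * transpose_mat K = 1\<^sub>m k"
    by (simp_all only: transpose_mult[OF L(1) K(1), symmetric] transpose_mult[OF K(1) L(1), symmetric]
        K transpose_one)
  have c_S: "c S = 1\<^sub>m k"
  proof -
    have "c S = (transpose_mat L * transpose_mat K) * (K * L)"
      unfolding c_def S_def using K(1) L(1) by (simp add: assoc_mult_mat[of _ k k _ k _ k])
    then show ?thesis by (simp add: K KLT)
  qed
  have c_inj: "T = S" if "T \<in> carrier_mat k k" "c T = 1\<^sub>m k" for T
  proof -
    have "transpose_mat K * c T * K = (transpose_mat K * transpose_mat L) * T * (L * K)"
      unfolding c_def using K(1) L(1) that by (simp add: assoc_mult_mat[of _ k k _ k _ k] del: K KLT)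
    then have "T = transpose_mat K * c T * K" using that by (simp add: K KLT)
    then show ?thesis by (simp add: that S_def)
  qed
  \<comment> \<open>Cyclicity of the trace expresses the value through \<open>c T\<close> alone, up
    to the constant \<open>ln (det N)\<close>.\<close>
  have val: "ln (det T) - mat_trace (T * N) = ln (det (c T)) - ln (det N) - mat_trace (c T)"
    if T: "T \<in> pos_def_mats k" for T
  proof -
    have Tc: "T \<in> carrier_mat k k" using T by (rule pos_def_matsD)
    have "det (c T) = det N * det T"
      unfolding c_def L(2) using L(1) Tc by (simp add: det_mult[of _ k] det_transpose[of _ k])
    then have "ln (det (c T)) = ln (det N) + ln (det T)"
      using det_pos_def[OF N] det_pos_def[OF T] by (simp add: ln_mult)
    moreover have "mat_trace (T * N) = mat_trace ((T * L) * transpose_mat L)"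
      using L Tc by (simp add: assoc_mult_mat[of _ k k _ k _ k])
    moreover have "\<dots> = mat_trace (transpose_mat L * (T * L))"
      using L(1) Tc by (intro mat_trace_comm) auto
    moreover have "transpose_mat L * (T * L) = c T"
      unfolding c_def using L(1) Tc by (simp add: assoc_mult_mat[of _ k k _ k _ k])
    ultimately show ?thesis by simp
  qed
  show ?thesis
  proof (rule that[OF S])
    fix T assume T: "T \<in> pos_def_mats k" "T \<noteq> S"
    then have "c T \<noteq> 1\<^sub>m k" using c_inj pos_def_matsD(1) by blast
    moreover have "c T \<in> pos_def_mats k"
      unfolding c_def by (rule congruence_pos_def[OF T(1) L(1) det_L])
    ultimately have "ln (det (c T)) < mat_trace (c T) - real k" by (rule ln_det_less_trace[rotated])
    then show "ln (det T) - mat_trace (T * N) < ln (det S) - mat_trace (S * N)"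
      unfolding val[OF T(1)] val[OF S] c_S by (simp add: mat_trace_def[of "1\<^sub>m k"])
  qed
qed

section \<open>The covariance terms of the bound\<close>

text \<open>Twice the part of the bound that contains one factor covariance; it serves the shared
  and the study-specific factors, each with its own loadings.\<close>

definition factor_term :: "nat \<Rightarrow> real \<Rightarrow> real mat \<Rightarrow> real mat \<Rightarrow> real" where
  "factor_term p l A T = ln (det T) - mat_trace T - (\<Sum>j<p. row A j \<bullet> (T *\<^sub>v row A j)) / l"

text \<open>The quadratic forms in the rows of \<open>A\<close> add up to the trace of
  \<open>T\<close> times the Gram matrix of \<open>A\<close>, so both penalties merge into one trace
  with \<open>N\<close>.\<close>

lemma factor_covariance_max:
  fixes A :: "real mat"
  assumes A: "A \<in> carrier_mat p k" and l: "l > 0"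
  obtains S where "S \<in> pos_def_mats k"
    "\<And>T. T \<in> pos_def_mats k \<Longrightarrow> T \<noteq> S \<Longrightarrow>
       factor_term p l A T < factor_term p l A S"
proof -
  define N where "N = mat k k (\<lambda>(i, m). (if i = m then 1 else 0) + (\<Sum>j<p. A $$ (j, i) * A $$ (j, m)) / l)"
  have Nc: "N \<in> carrier_mat k k" by (simp add: N_def)
  have "N \<in> pos_def_mats k"
  proof (rule pos_def_matsI[OF Nc])
    show "N $$ (i, j) = N $$ (j, i)" if "i < k" "j < k" for i j
      using that by (simp add: N_def mult.commute)
    fix v :: "real vec" assume v: "v \<in> carrier_vec k" "v \<noteq> 0\<^sub>v k"
    \<comment> \<open>The goal is that the form equals the squared norm of \<open>v\<close> plus
      that of \<open>A *\<^sub>v v\<close> divided by \<open>l\<close>; moving the sum over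
      \<open>j\<close> outside exposes the squares.\<close>
    have "v \<bullet> (N *\<^sub>v v) = (\<Sum>i<k. \<Sum>m<k. (if i = m then v $ i * v $ m else 0)
        + (\<Sum>j<p. (A $$ (j, i) * v $ i) * (A $$ (j, m) * v $ m)) / l)"
      unfolding quadratic_form_sum[OF Nc v(1)]
      by (intro sum.cong refl) (auto simp: N_def algebra_simps sum_distrib_left sum_divide_distrib)
    also have "\<dots> = v \<bullet> v + (\<Sum>i<k. \<Sum>m<k. \<Sum>j<p. (A $$ (j, i) * v $ i) * (A $$ (j, m) * v $ m)) / l"
      using v(1) by (simp add: sum.distrib sum_divide_distrib scalar_prod_def lessThan_atLeast0)
    also have "(\<Sum>i<k. \<Sum>m<k. \<Sum>j<p. (A $$ (j, i) * v $ i) * (A $$ (j, m) * v $ m))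
        = (\<Sum>i<k. \<Sum>j<p. \<Sum>m<k. (A $$ (j, i) * v $ i) * (A $$ (j, m) * v $ m))"
      by (intro sum.cong refl sum.swap)
    also have "\<dots> = (\<Sum>j<p. \<Sum>i<k. \<Sum>m<k. (A $$ (j, i) * v $ i) * (A $$ (j, m) * v $ m))"
      by (rule sum.swap)
    also have "\<dots> = (\<Sum>j<p. (\<Sum>i<k. A $$ (j, i) * v $ i)\<^sup>2)"
      by (simp add: power2_eq_square sum_product)
    finally show "0 < v \<bullet> (N *\<^sub>v v)"
      using self_scalar_prod_pos[OF v] l by (simp add: add_pos_nonneg sum_nonneg)
  qed
  then obtain S where S: "S \<in> pos_def_mats k"
    "\<And>T. T \<in> pos_def_mats k \<Longrightarrow> T \<noteq> S \<Longrightarrow>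
       ln (det T) - mat_trace (T * N) < ln (det S) - mat_trace (S * N)"
    using ln_det_minus_trace_max by blast
  have "mat_trace (T * N) = mat_trace T + (\<Sum>j<p. row A j \<bullet> (T *\<^sub>v row A j)) / l"
    if T: "T \<in> pos_def_mats k" for T
  proof -
    have Tc: "T \<in> carrier_mat k k" using T by (rule pos_def_matsD)
    have "mat_trace (T * N) = (\<Sum>i<k. \<Sum>m<k. T $$ (i, m) * N $$ (m, i))"
      using Tc Nc by (simp add: mat_trace_def scalar_prod_def lessThan_atLeast0)
    also have "\<dots> = (\<Sum>i<k. \<Sum>m<k. (if i = m then T $$ (i, m) else 0)
        + (\<Sum>j<p. A $$ (j, i) * T $$ (i, m) * A $$ (j, m)) / l)"
      by (intro sum.cong refl) (auto simp: N_def algebra_simps sum_distrib_left sum_divide_distrib)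
    also have "\<dots> = mat_trace T + (\<Sum>i<k. \<Sum>m<k. \<Sum>j<p. A $$ (j, i) * T $$ (i, m) * A $$ (j, m)) / l"
      using Tc by (simp add: sum.distrib sum_divide_distrib mat_trace_def)
    also have "(\<Sum>i<k. \<Sum>m<k. \<Sum>j<p. A $$ (j, i) * T $$ (i, m) * A $$ (j, m))
        = (\<Sum>i<k. \<Sum>j<p. \<Sum>m<k. A $$ (j, i) * T $$ (i, m) * A $$ (j, m))"
      by (intro sum.cong refl sum.swap)
    also have "\<dots> = (\<Sum>j<p. \<Sum>i<k. \<Sum>m<k. A $$ (j, i) * T $$ (i, m) * A $$ (j, m))"
      by (rule sum.swap)
    also have "\<dots> = (\<Sum>j<p. row A j \<bullet> (T *\<^sub>v row A j))"
      using A Tc by (intro sum.cong refl) (auto simp: quadratic_form_sum[OF Tc])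
    finally show ?thesis .
  qed
  then show ?thesis
    using S by (intro that[of S]) (auto simp: factor_term_def algebra_simps)
qed

subsection \<open>The profiled likelihood\<close>

lemma is_arg_max_real_iff:
  "is_arg_max f P y \<longleftrightarrow> P y \<and> (\<forall>y'. P y' \<longrightarrow> f y' \<le> f y)" for f :: "'a \<Rightarrow> real"
  by (auto simp: is_arg_max_def not_less)

section \<open>The unique maximizer for one observation\<close>

text \<open>The bound is a constant plus three functions of disjoint groups of components of \<xi>,
  each with a unique maximizer on its own domain.\<close>

lemma elbo_unique_maximizer:
  assumes \<theta>: "\<theta> \<in> study_params p d q r" and a: "a > 0"
  shows "\<exists>!\<xi>. is_arg_max (elbo p x z a c \<theta>) (\<lambda>\<xi>. \<xi> \<in> var_params p q r) \<xi>"
proof -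
  define l where "l = sp_lambda \<theta>"
  define A where "A = sp_A \<theta>"
  define B where "B = sp_B \<theta>"
  have l: "l > 0" and A: "A \<in> carrier_mat p q" and B: "B \<in> carrier_mat p r"
    using \<theta> by (auto simp: study_params_def l_def A_def B_def)
  \<comment> \<open>The disjoint sum of index sets stacks the two kinds of factors, with
    \<open>A\<close> and \<open>B\<close> side by side as loadings.\<close>
  interpret latent_objective "{..<p}" "{..<q} <+> {..<r}" a l "\<lambda>j. real (x $ j)"
    "\<lambda>j. z \<bullet> row (sp_beta \<theta>) j" "\<lambda>j. case_sum (\<lambda>k. A $$ (j, k)) (\<lambda>k. B $$ (j, k))"
    by unfold_locales (use a l in auto)
  define F where "F \<xi> = objective (($) (vp_mu \<xi>)) (($) (vp_sigma2 \<xi>))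
      (case_sum (($) (vp_mf \<xi>)) (($) (vp_mh \<xi>)))" for \<xi> :: var_param
  have elbo_split: "elbo p x z a c \<theta> \<xi> = F \<xi> + factor_term p l A (vp_Sf \<xi>) / 2
      + factor_term p l B (vp_Sh \<xi>) / 2 + (c - real p * ln l / 2)"
    if \<xi>: "\<xi> \<in> var_params p q r" for \<xi>
  proof -
    let ?u = "case_sum (($) (vp_mf \<xi>)) (($) (vp_mh \<xi>))"
    let ?qf = "\<lambda>j. row A j \<bullet> (vp_Sf \<xi> *\<^sub>v row A j)" and ?qh = "\<lambda>j. row B j \<bullet> (vp_Sh \<xi> *\<^sub>v row B j)"
    have dim: "vp_mf \<xi> \<in> carrier_vec q" "vp_mh \<xi> \<in> carrier_vec r"
      using \<xi> by (auto simp: var_params_def)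
    have resid: "resid (($) (vp_mu \<xi>)) ?u j = vp_mu \<xi> $ j - z \<bullet> row (sp_beta \<theta>) j - row A j \<bullet> vp_mf \<xi>
        - row B j \<bullet> vp_mh \<xi>" if "j < p" for j
    proof -
      have "row A j \<bullet> vp_mf \<xi> = (\<Sum>k<q. A $$ (j, k) * vp_mf \<xi> $ k)"
        "row B j \<bullet> vp_mh \<xi> = (\<Sum>k<r. B $$ (j, k) * vp_mh \<xi> $ k)"
        using that dim A B by (simp_all add: scalar_prod_def lessThan_atLeast0)
      then show ?thesis by (simp add: resid_def sum.Plus)
    qed
    have "real (x $ j) * vp_mu \<xi> $ j - a * exp (vp_mu \<xi> $ j + vp_sigma2 \<xi> $ j / 2)
        - 1/2 * ((vp_mu \<xi> $ j - z \<bullet> row (sp_beta \<theta>) j - row A j \<bullet> vp_mf \<xi> - row B j \<bullet> vp_mh \<xi>)\<^sup>2 / l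
                 + 1 / l * (vp_sigma2 \<xi> $ j + ?qf j + ?qh j) + ln l)
      = summand (($) (vp_mu \<xi>)) (($) (vp_sigma2 \<xi>)) ?u j - ln (vp_sigma2 \<xi> $ j) / 2
        - ?qf j / l / 2 - ?qh j / l / 2 - ln l / 2" if "j < p" for j
      unfolding summand_def resid[OF that] by (simp add: add_divide_distrib algebra_simps)
    then have "(\<Sum>j<p. real (x $ j) * vp_mu \<xi> $ j - a * exp (vp_mu \<xi> $ j + vp_sigma2 \<xi> $ j / 2)
        - 1/2 * ((vp_mu \<xi> $ j - z \<bullet> row (sp_beta \<theta>) j - row A j \<bullet> vp_mf \<xi> - row B j \<bullet> vp_mh \<xi>)\<^sup>2 / l
                 + 1 / l * (vp_sigma2 \<xi> $ j + ?qf j + ?qh j) + ln l))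
      = (\<Sum>j<p. summand (($) (vp_mu \<xi>)) (($) (vp_sigma2 \<xi>)) ?u j) - (\<Sum>j<p. ln (vp_sigma2 \<xi> $ j)) / 2
        - (\<Sum>j<p. ?qf j) / l / 2 - (\<Sum>j<p. ?qh j) / l / 2 - real p * ln l / 2"
      by (simp add: sum_subtractf sum_divide_distrib)
    moreover have "(\<Sum>k\<in>{..<q} <+> {..<r}. (?u k)\<^sup>2) = vp_mf \<xi> \<bullet> vp_mf \<xi> + vp_mh \<xi> \<bullet> vp_mh \<xi>"
      using dim by (simp add: sum.Plus scalar_prod_def power2_eq_square lessThan_atLeast0)
    ultimately show ?thesis
      unfolding elbo_def F_def objective_def factor_term_def A_def[symmetric] B_def[symmetric] l_def[symmetric]
      by argo
  qed
  obtain m s u where s: "\<forall>j\<in>{..<p}. s j > 0"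
    and max: "\<And>m' s' u'. \<forall>j\<in>{..<p}. s' j > 0 \<Longrightarrow> objective m' s' u' \<le> objective m s u"
    by (rule objective_max_exists) (rule that)
  obtain Sf where Sf: "Sf \<in> pos_def_mats q"
    "\<And>T. T \<in> pos_def_mats q \<Longrightarrow> T \<noteq> Sf \<Longrightarrow> factor_term p l A T < factor_term p l A Sf"
    by (rule factor_covariance_max[OF A l]) (rule that)
  obtain Sh where Sh: "Sh \<in> pos_def_mats r"
    "\<And>T. T \<in> pos_def_mats r \<Longrightarrow> T \<noteq> Sh \<Longrightarrow> factor_term p l B T < factor_term p l B Sh"
    by (rule factor_covariance_max[OF B l]) (rule that)
  \<comment> \<open>The three maximizers are assembled; \<open>vec\<close> keeps just the
    coordinates that the objective sees.\<close>
  define \<xi>0 where "\<xi>0 = \<lparr>vp_mu = vec p m, vp_sigma2 = vec p s, vp_mf = vec q (u \<circ> Inl), vp_Sf = Sf,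
    vp_mh = vec r (u \<circ> Inr), vp_Sh = Sh\<rparr>"
  have \<xi>0: "\<xi>0 \<in> var_params p q r"
    using s Sf(1) Sh(1) by (simp add: \<xi>0_def var_params_def)
  have F0: "F \<xi>0 = objective m s u"
    unfolding F_def by (rule objective_cong) (auto simp: \<xi>0_def)
  have le: "F \<xi> \<le> F \<xi>0" "factor_term p l A (vp_Sf \<xi>) \<le> factor_term p l A Sf"
    "factor_term p l B (vp_Sh \<xi>) \<le> factor_term p l B Sh"
    if \<xi>: "\<xi> \<in> var_params p q r" for \<xi>
  proof -
    show "F \<xi> \<le> F \<xi>0"
      unfolding F0 using \<xi> by (auto simp: F_def var_params_def intro: max)
    show "factor_term p l A (vp_Sf \<xi>) \<le> factor_term p l A Sf"
      "factor_term p l B (vp_Sh \<xi>) \<le> factor_term p l B Sh"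
      using \<xi> Sf(2)[of "vp_Sf \<xi>"] Sh(2)[of "vp_Sh \<xi>"] by (auto simp: var_params_def less_le)
  qed
  have S0: "vp_Sf \<xi>0 = Sf" "vp_Sh \<xi>0 = Sh" by (simp_all add: \<xi>0_def)
  show ?thesis
  proof (rule ex1I[of _ \<xi>0])
    have "elbo p x z a c \<theta> \<xi> \<le> elbo p x z a c \<theta> \<xi>0" if "\<xi> \<in> var_params p q r" for \<xi>
      using le[OF that] unfolding elbo_split[OF that] elbo_split[OF \<xi>0] S0 by argo
    then show "is_arg_max (elbo p x z a c \<theta>) (\<lambda>\<xi>. \<xi> \<in> var_params p q r) \<xi>0"
      using \<xi>0 by (simp add: is_arg_max_real_iff)
  next
    fix \<xi> assume "is_arg_max (elbo p x z a c \<theta>) (\<lambda>\<xi>. \<xi> \<in> var_params p q r) \<xi>"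
    then have \<xi>: "\<xi> \<in> var_params p q r" and "elbo p x z a c \<theta> \<xi>0 \<le> elbo p x z a c \<theta> \<xi>"
      using \<xi>0 by (auto simp: is_arg_max_real_iff)
    \<comment> \<open>None of the three parts exceeds its maximum, while their sum is at least the
      sum of the maxima; so each part is maximal.\<close>
    then have eq: "F \<xi> = F \<xi>0" "factor_term p l A (vp_Sf \<xi>) = factor_term p l A Sf"
      "factor_term p l B (vp_Sh \<xi>) = factor_term p l B Sh"
      using le[OF \<xi>] unfolding elbo_split[OF \<xi>] elbo_split[OF \<xi>0] S0 by argo+
    have "vp_Sf \<xi> = Sf" "vp_Sh \<xi> = Sh"
      using eq(2,3) \<xi> Sf(2)[of "vp_Sf \<xi>"] Sh(2)[of "vp_Sh \<xi>"] by (auto simp: var_params_def)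
    moreover have agree: "(\<forall>j\<in>{..<p}. m j = vp_mu \<xi> $ j \<and> s j = vp_sigma2 \<xi> $ j) \<and>
        (\<forall>k\<in>{..<q} <+> {..<r}. u k = case_sum (($) (vp_mf \<xi>)) (($) (vp_mh \<xi>)) k)"
    proof (rule objective_max_unique[OF s _ max])
      show "\<forall>j\<in>{..<p}. vp_sigma2 \<xi> $ j > 0" using \<xi> by (simp add: var_params_def)
      show "objective (($) (vp_mu \<xi>)) (($) (vp_sigma2 \<xi>)) (case_sum (($) (vp_mf \<xi>)) (($) (vp_mh \<xi>)))
          = objective m s u"
        using eq(1) unfolding F0 by (simp add: F_def)
    qed
    have "vp_mu \<xi> = vec p m" "vp_sigma2 \<xi> = vec p s"
      "vp_mf \<xi> = vec q (u \<circ> Inl)" "vp_mh \<xi> = vec r (u \<circ> Inr)"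
      using \<xi> agree by (auto simp: var_params_def Plus_def intro!: eq_vecI)
    ultimately show "\<xi> = \<xi>0" by (cases \<xi>) (simp add: \<xi>0_def)
  qed
qed

section \<open>Joint maximization and the profile\<close>

text \<open>As \<Theta> is an arbitrary set of model parameters, it may incorporate identifiability
  constraints. The equality of sets covers several maximizers and also the case of none.\<close>

theorem theorem2:
  fixes p d q S :: nat
    and qs n :: "nat \<Rightarrow> nat"
    and x :: "nat \<Rightarrow> nat \<Rightarrow> nat vec"
    and z :: "nat \<Rightarrow> nat \<Rightarrow> real vec"
    and a c :: "nat \<Rightarrow> nat \<Rightarrow> real"
    and \<Theta> :: "model_param set"
  assumes x: "\<And>s i. s \<in> {1..S} \<Longrightarrow> i \<in> {1..n s} \<Longrightarrow> x s i \<in> carrier_vec p"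
    and z: "\<And>s i. s \<in> {1..S} \<Longrightarrow> i \<in> {1..n s} \<Longrightarrow> z s i \<in> carrier_vec d"
    and a: "\<And>s i. s \<in> {1..S} \<Longrightarrow> i \<in> {1..n s} \<Longrightarrow> a s i > 0"
    and \<Theta>: "\<Theta> \<subseteq> model_params p d q qs S"
  shows "(\<forall>s\<in>{1..S}. \<forall>i\<in>{1..n s}. \<forall>\<theta>\<in>study_params p d q (qs s).
            \<exists>!\<xi>. is_arg_max (elbo p (x s i) (z s i) (a s i) (c s i) \<theta>)
                   (\<lambda>\<xi>. \<xi> \<in> var_params p q (qs s)) \<xi>)
       \<and> mvle p q qs S n x z a c \<Theta> =
           {\<theta>. is_arg_max (profile_loglik p q qs S n x z a c) (\<lambda>\<theta>. \<theta> \<in> \<Theta>) \<theta>}"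
proof
  show unique: "\<forall>s\<in>{1..S}. \<forall>i\<in>{1..n s}. \<forall>\<theta>\<in>study_params p d q (qs s).
            \<exists>!\<xi>. is_arg_max (elbo p (x s i) (z s i) (a s i) (c s i) \<theta>)
                   (\<lambda>\<xi>. \<xi> \<in> var_params p q (qs s)) \<xi>"
    using a elbo_unique_maximizer by blast
  define E where "E \<theta> s i = elbo p (x s i) (z s i) (a s i) (c s i) (at_study \<theta> s)" for \<theta> s i
  define \<xi>m where "\<xi>m \<theta> s i = arg_max (E \<theta> s i) (\<lambda>\<xi>. \<xi> \<in> var_params p q (qs s))" for \<theta> s i
  \<comment> \<open>The restricted abstractions make the family of optimal variational parameters
    extensional, as membership in \<open>var_families\<close> demands.\<close>
  define \<Xi> where "\<Xi> \<theta> = (\<lambda>s\<in>{1..S}. \<lambda>i\<in>{1..n s}. \<xi>m \<theta> s i)" for \<theta>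
  let ?total = "total_elbo p S n x z a c" and ?profile = "profile_loglik p q qs S n x z a c"
  let ?V = "var_families p q qs S n"
  have total: "?total \<theta> \<xi> = (\<Sum>s=1..S. \<Sum>i=1..n s. E \<theta> s i (\<xi> s i))" for \<theta> \<xi>
    by (simp add: total_elbo_def E_def)
  have profile: "?profile \<theta> = (\<Sum>s=1..S. \<Sum>i=1..n s. E \<theta> s i (\<xi>m \<theta> s i))" for \<theta>
    by (simp add: profile_loglik_def rho_def E_def \<xi>m_def)
  have \<xi>m: "\<xi>m \<theta> s i \<in> var_params p q (qs s)"
    "\<And>\<xi>. \<xi> \<in> var_params p q (qs s) \<Longrightarrow> E \<theta> s i \<xi> \<le> E \<theta> s i (\<xi>m \<theta> s i)"
    if "\<theta> \<in> \<Theta>" "s \<in> {1..S}" "i \<in> {1..n s}" for \<theta> s i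
  proof -
    have "at_study \<theta> s \<in> study_params p d q (qs s)"
      using that(1,2) \<Theta> by (fastforce simp: model_params_def study_params_def at_study_def PiE_def Pi_def)
    then have "\<exists>\<xi>. is_arg_max (E \<theta> s i) (\<lambda>\<xi>. \<xi> \<in> var_params p q (qs s)) \<xi>"
      using unique that(2,3) unfolding E_def by blast
    then have "is_arg_max (E \<theta> s i) (\<lambda>\<xi>. \<xi> \<in> var_params p q (qs s)) (\<xi>m \<theta> s i)"
      unfolding \<xi>m_def arg_max_def by (rule someI_ex)
    then show "\<xi>m \<theta> s i \<in> var_params p q (qs s)"
      "\<And>\<xi>. \<xi> \<in> var_params p q (qs s) \<Longrightarrow> E \<theta> s i \<xi> \<le> E \<theta> s i (\<xi>m \<theta> s i)"
      by (auto simp: is_arg_max_real_iff)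
  qed
  have \<Xi>: "\<Xi> \<theta> \<in> ?V" if "\<theta> \<in> \<Theta>" for \<theta>
    using \<xi>m(1)[OF that] by (simp add: \<Xi>_def var_families_def)
  have attained: "?total \<theta> (\<Xi> \<theta>) = ?profile \<theta>" for \<theta>
    by (simp add: total profile \<Xi>_def)
  \<comment> \<open>Each observation has its own variational parameter, so the sum is bounded term
    by term; with \<open>attained\<close>, the profile is the maximum over \<xi>.\<close>
  have bound: "?total \<theta> \<xi> \<le> ?profile \<theta>" if "\<theta> \<in> \<Theta>" "\<xi> \<in> ?V" for \<theta> \<xi>
    unfolding total profile
    using that by (intro sum_mono \<xi>m(2)) (auto simp: var_families_def PiE_def Pi_def)
  have "\<theta> \<in> mvle p q qs S n x z a c \<Theta> \<longleftrightarrow>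
      (\<exists>\<xi>. \<theta> \<in> \<Theta> \<and> \<xi> \<in> ?V \<and> (\<forall>\<theta>'\<in>\<Theta>. \<forall>\<xi>'\<in>?V. ?total \<theta>' \<xi>' \<le> ?total \<theta> \<xi>))" for \<theta>
    unfolding mvle_def by (force simp: is_arg_max_real_iff image_iff)
  moreover have "(\<exists>\<xi>. \<theta> \<in> \<Theta> \<and> \<xi> \<in> ?V \<and> (\<forall>\<theta>'\<in>\<Theta>. \<forall>\<xi>'\<in>?V. ?total \<theta>' \<xi>' \<le> ?total \<theta> \<xi>)) \<longleftrightarrow>
      \<theta> \<in> \<Theta> \<and> (\<forall>\<theta>'\<in>\<Theta>. ?profile \<theta>' \<le> ?profile \<theta>)" for \<theta>
  proof
    assume "\<exists>\<xi>. \<theta> \<in> \<Theta> \<and> \<xi> \<in> ?V \<and> (\<forall>\<theta>'\<in>\<Theta>. \<forall>\<xi>'\<in>?V. ?total \<theta>' \<xi>' \<le> ?total \<theta> \<xi>)"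
    then obtain \<xi> where \<theta>: "\<theta> \<in> \<Theta>" "\<xi> \<in> ?V"
      and max: "\<And>\<theta>' \<xi>'. \<theta>' \<in> \<Theta> \<Longrightarrow> \<xi>' \<in> ?V \<Longrightarrow> ?total \<theta>' \<xi>' \<le> ?total \<theta> \<xi>"
      by blast
    \<comment> \<open>The profile at \<theta>' is the total at \<theta>' and
      \<open>\<Xi> \<theta>'\<close>, hence at most the joint maximum, which is at most the profile
      at \<theta>.\<close>
    have "?profile \<theta>' \<le> ?profile \<theta>" if "\<theta>' \<in> \<Theta>" for \<theta>'
      using max[OF that \<Xi>[OF that]] bound[OF \<theta>] unfolding attained by (rule order_trans)
    then show "\<theta> \<in> \<Theta> \<and> (\<forall>\<theta>'\<in>\<Theta>. ?profile \<theta>' \<le> ?profile \<theta>)" using \<theta>(1) by blast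
  next
    assume \<theta>: "\<theta> \<in> \<Theta> \<and> (\<forall>\<theta>'\<in>\<Theta>. ?profile \<theta>' \<le> ?profile \<theta>)"
    \<comment> \<open>Conversely, any total is at most its profile, hence at most the profile at
      \<theta>, which \<open>\<Xi> \<theta>\<close> attains.\<close>
    have "?total \<theta>' \<xi>' \<le> ?total \<theta> (\<Xi> \<theta>)" if "\<theta>' \<in> \<Theta>" "\<xi>' \<in> ?V" for \<theta>' \<xi>'
      using bound[OF that] \<theta> that(1) unfolding attained by (meson order_trans)
    then show "\<exists>\<xi>. \<theta> \<in> \<Theta> \<and> \<xi> \<in> ?V \<and> (\<forall>\<theta>'\<in>\<Theta>. \<forall>\<xi>'\<in>?V. ?total \<theta>' \<xi>' \<le> ?total \<theta> \<xi>)"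
      using \<theta> \<Xi> by blast
  qed
  ultimately show "mvle p q qs S n x z a c \<Theta> = {\<theta>. is_arg_max ?profile (\<lambda>\<theta>. \<theta> \<in> \<Theta>) \<theta>}"
    by (auto simp: is_arg_max_real_iff)
qed

end
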